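(* Let $\alpha\in[0,1]$ be a real number. Then there exists $A\subset\mathbb{N}$ with $d(A)=\alpha$ such that no subset $B\subset\mathbb{N}\setminus A$ is an additive complement of $A$.
   Context: $\mathbb{N}$ denotes the set of positive integers. For $A,B\subset\mathbb{N}$, $A+B=\{x+y: x\in A,\ y\in B\}$. A set $B\subset\mathbb{N}$ is an additive complement of $A\subset\mathbb{N}$ if $\mathbb{N}\setminus(A+B)$ is finite. For $A\subset\mathbb{N}$, the upper and lower asymptotic densities are $\overline{d}(A)=\limsup_{n\to\infty}\frac{|A\cap[1,n]|}{n}$ and $\underline{d}(A)=\liminf_{n\to\infty}\frac{|A\cap[1,n]|}{n}$; if they are equal, the density $d(A)$ is said to exist and is their common value. The assertion $d(A)=\alpha$ means that the density exists and equals $\alpha$. *)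

theory Defs
  imports Complex_Main "HOL-Library.Extended_Real" "HOL-Library.Set_Algebras"
begin

(* Subsets of the positive integers are modelled as sets of type nat set contained in Npos. *)
abbreviation Npos :: "nat set" where
  "Npos \<equiv> {n. 1 \<le> n}"

(* The index n = 0 contributes the value 0 / 0 = 0, which does not affect limsup or liminf. *)
definition upper_density :: "nat set \<Rightarrow> ereal" where
  "upper_density A = limsup (\<lambda>n. ereal (real (card (A \<inter> {1..n})) / real n))"

definition lower_density :: "nat set \<Rightarrow> ereal" where
  "lower_density A = liminf (\<lambda>n. ereal (real (card (A \<inter> {1..n})) / real n))"

definition has_density :: "nat set \<Rightarrow> real \<Rightarrow> bool" where
  "has_density A \<alpha> \<longleftrightarrow> upper_density A = ereal \<alpha> \<and> lower_density A = ereal \<alpha>"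

(* Here A + B is the elementwise sumset of Set_Algebras.  The requirement that A and B
   are subsets of Npos is left to the place of use. *)
definition additive_complement :: "nat set \<Rightarrow> nat set \<Rightarrow> bool" where
  "additive_complement B A \<longleftrightarrow> finite (Npos - (A + B))"

end

theory Submission
  imports Defs "HOL-Real_Asymp.Real_Asymp"
begin

text \<open>
  Enlarging \<open>B\<close> enlarges \<open>A + B\<close>, so the best candidate is the whole complement of \<open>A\<close>, and a
  number \<open>n\<close> lies outside \<open>A + (Npos - A)\<close> exactly when \<open>A\<close> is invariant under the reflection
  \<open>m \<mapsto> n - m\<close> of \<open>{1..<n}\<close>. It therefore suffices to find a set of density \<open>\<alpha>\<close> that is
  symmetric in this sense for infinitely many \<open>n\<close>.

  The 2-adic valuation \<open>v\<close> satisfies \<open>v (2 ^ K - m) = v m\<close> for \<open>0 < m < 2 ^ K\<close>. Hence every set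
  of the form \<open>{m. v m \<in> S}\<close> is symmetric for all the powers of two at once. The numbers of
  valuation \<open>k\<close> have density \<open>1 / 2 ^ (k + 1)\<close>, so letting \<open>S\<close> consist of the positions of the
  digits 1 in a binary expansion of \<open>\<alpha>\<close> gives the set density \<open>\<alpha>\<close>.

  Digits are read off by iterating the doubling map, and halving \<open>m\<close> lowers its valuation by one;
  treating both at once makes the symmetry (\<open>digit_at_valuation_reflect\<close>) and the discrepancy
  bound (\<open>digit_set_discrepancy\<close>) simple inductions that never mention \<open>v\<close> or infinite sums.
\<close>

text \<open>
  The map removing the first binary digit of a number in the unit interval. The branches are chosen
  so that 1 is a fixed point, which gives it the expansion \<open>0.111...\<close> and saves a special case.
\<close>

definition doubling :: "real \<Rightarrow> real" where
  "doubling x = (if 1 / 2 \<le> x then 2 * x - 1 else 2 * x)"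

text \<open>
  For \<open>m > 0\<close> this says that the binary digit of \<open>x\<close> at place \<open>v m\<close> is 1, places being counted
  from 0 after the binary point.
\<close>

fun digit_at_valuation :: "real \<Rightarrow> nat \<Rightarrow> bool" where
  "digit_at_valuation x m =
     (if m = 0 then False
      else if odd m then 1 / 2 \<le> x
      else digit_at_valuation (doubling x) (m div 2))"

declare digit_at_valuation.simps [simp del]

definition digit_set :: "real \<Rightarrow> nat set" where
  "digit_set x = {m. digit_at_valuation x m}"

lemma digit_at_valuation_0 [simp]: "\<not> digit_at_valuation x 0"
  by (simp add: digit_at_valuation.simps)

lemma digit_at_valuation_odd: "odd m \<Longrightarrow> digit_at_valuation x m \<longleftrightarrow> 1 / 2 \<le> x"
  by (subst digit_at_valuation.simps) (auto elim: oddE)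

lemma digit_at_valuation_double:
  "digit_at_valuation x (2 * m) \<longleftrightarrow> digit_at_valuation (doubling x) m"
  by (cases "m = 0") (simp_all add: digit_at_valuation.simps [of x "2 * m"])

lemma digit_set_subset_Npos: "digit_set x \<subseteq> Npos"
  by (auto simp: digit_set_def Suc_le_eq intro!: gr0I)

section \<open>Symmetry about the powers of two\<close>

text \<open>
  Reflection at \<open>2 ^ Suc K\<close> preserves parity, and on the even numbers it is twice the reflection at
  \<open>2 ^ K\<close>; this is the invariance of the valuation, unfolded one digit at a time.
\<close>

lemma digit_at_valuation_reflect:
  assumes "0 < m" "m < 2 ^ K"
  shows "digit_at_valuation x (2 ^ K - m) \<longleftrightarrow> digit_at_valuation x m"
  using assms
proof (induction K arbitrary: x m)
  case 0
  then show ?case by simp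
next
  case (Suc K)
  show ?case
  proof (cases "odd m")
    case True
    with Suc.prems have "odd (2 ^ Suc K - m)" by simp
    with True show ?thesis by (simp add: digit_at_valuation_odd)
  next
    case False
    then obtain k where k: "m = 2 * k" by (auto elim: evenE)
    with Suc.prems have "0 < k" "k < 2 ^ K" by simp_all
    moreover have "2 ^ Suc K - m = 2 * (2 ^ K - k)" by (simp add: k)
    ultimately show ?thesis
      by (simp only: k digit_at_valuation_double Suc.IH)
  qed
qed

lemma power_two_notin_sumset:
  assumes "B \<subseteq> Npos - digit_set x"
  shows "2 ^ K \<notin> digit_set x + B"
proof
  assume "2 ^ K \<in> digit_set x + B"
  then obtain a b where ab: "2 ^ K = a + b" "a \<in> digit_set x" "b \<in> B"
    by (auto elim: set_plus_elim)
  with assms have "0 < b" "b \<notin> digit_set x" by auto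
  moreover have "0 < a" using ab(2) digit_set_subset_Npos by fastforce
  ultimately have "digit_at_valuation x (2 ^ K - a)"
    using ab digit_at_valuation_reflect [of a K x] by (simp add: digit_set_def)
  moreover have "2 ^ K - a = b" using ab(1) by simp
  ultimately show False using \<open>b \<notin> digit_set x\<close> by (simp add: digit_set_def)
qed

lemma not_additive_complement_digit_set:
  assumes "B \<subseteq> Npos - digit_set x"
  shows "\<not> additive_complement B (digit_set x)"
proof
  assume "additive_complement B (digit_set x)"
  moreover have "range (\<lambda>K. 2 ^ K) \<subseteq> Npos - (digit_set x + B)"
    using power_two_notin_sumset [OF assms] by auto
  ultimately have "finite (range (\<lambda>K. 2 ^ K :: nat))"
    unfolding additive_complement_def by (rule finite_subset [rotated])
  moreover have "inj (\<lambda>K. 2 ^ K :: nat)" by (simp add: inj_on_def)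
  ultimately show False by (simp add: finite_image_iff)
qed

section \<open>Density\<close>

lemma card_odd_atMost: "card {m \<in> {1..n}. odd m} = (n + 1) div 2"
proof -
  have "{m \<in> {1..n}. odd m} = (\<lambda>k. 2 * k + 1) ` {..<(n + 1) div 2}"
    by (auto elim!: oddE)
  then show ?thesis by (simp add: card_image inj_on_def)
qed

text \<open>
  The first digit decides about all odd numbers; the even members are the doubles of the members
  of the set belonging to the remaining digits.
\<close>

lemma card_digit_set_halve:
  "card (digit_set x \<inter> {1..n}) =
     (if 1 / 2 \<le> x then (n + 1) div 2 else 0) + card (digit_set (doubling x) \<inter> {1..n div 2})"
proof -
  let ?O = "{m \<in> {1..n}. odd m \<and> 1 / 2 \<le> x}"
  let ?E = "(\<lambda>k. 2 * k) ` (digit_set (doubling x) \<inter> {1..n div 2})"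
  have "digit_set x \<inter> {1..n} = ?O \<union> ?E"
  proof (rule set_eqI)
    fix m
    show "m \<in> digit_set x \<inter> {1..n} \<longleftrightarrow> m \<in> ?O \<union> ?E"
    proof (cases "odd m")
      case True
      then show ?thesis by (auto simp: digit_set_def digit_at_valuation_odd)
    next
      case False
      then obtain k where "m = 2 * k" by (auto elim: evenE)
      then show ?thesis by (auto simp: digit_set_def digit_at_valuation_double image_iff)
    qed
  qed
  moreover have "card (?O \<union> ?E) = card ?O + card ?E"
    by (rule card_Un_disjoint) auto
  moreover have "card ?E = card (digit_set (doubling x) \<inter> {1..n div 2})"
    by (simp add: card_image inj_on_def)
  moreover have "card ?O = (if 1 / 2 \<le> x then (n + 1) div 2 else 0)"
    using card_odd_atMost [of n] by simp
  ultimately show ?thesis by simp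
qed

text \<open>
  Passing from \<open>n\<close> to \<open>n div 2\<close> changes the discrepancy by at most \<open>1 / 2\<close>, and by nothing when
  \<open>n\<close> is even. There are about \<open>log 2 n\<close> such steps.
\<close>

lemma digit_set_discrepancy:
  assumes "x \<in> {0..1}" "0 < n"
  shows "\<bar>real (card (digit_set x \<inter> {1..n})) - x * real n\<bar> \<le> log 2 (2 * real n) / 2"
  using assms
proof (induction n arbitrary: x rule: less_induct)
  case (less n)
  define q r where "q = n div 2" and "r = n mod 2"
  define b :: real where "b = (if 1 / 2 \<le> x then 1 else 0)"
  define y where "y = doubling x"
  define D where "D = real (card (digit_set y \<inter> {1..q})) - y * real q"
  have n: "n = 2 * q + r" and r: "r \<le> 1" by (auto simp: q_def r_def)
  have y: "y \<in> {0..1}" and x: "x = (b + y) / 2"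
    using less.prems(1) by (auto simp: y_def b_def doubling_def field_simps)
  have "(n + 1) div 2 = q + r" using n r by linarith
  then have "real (card (digit_set x \<inter> {1..n})) = b * (q + r) + card (digit_set y \<inter> {1..q})"
    using card_digit_set_halve [of x n] by (simp add: b_def flip: q_def y_def)
  then have "real (card (digit_set x \<inter> {1..n})) - x * real n = D + r * (b - y) / 2"
    by (simp add: D_def x n field_simps)
  moreover have "\<bar>r * (b - y) / 2\<bar> \<le> 1 / 2"
  proof -
    have "\<bar>b - y\<bar> \<le> 1" using y by (auto simp: b_def)
    moreover have "r = 0 \<or> r = 1" using r by linarith
    ultimately show ?thesis by auto
  qed
  ultimately have step: "\<bar>real (card (digit_set x \<inter> {1..n})) - x * real n\<bar> \<le> \<bar>D\<bar> + 1 / 2"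
    by linarith
  show ?case
  proof (cases "q = 0")
    case True
    with n r less.prems(2) have "n = 1" by linarith
    moreover have "D = 0" by (simp add: D_def True)
    ultimately show ?thesis using step by simp
  next
    case False
    then have "q < n" using n by linarith
    then have "\<bar>D\<bar> \<le> log 2 (2 * real q) / 2"
      unfolding D_def using less.IH y False by simp
    moreover have "log 2 (2 * (2 * real q)) = 1 + log 2 (2 * real q)"
      using False by (subst log_mult) auto
    moreover have "log 2 (2 * (2 * real q)) \<le> log 2 (2 * real n)"
      using False n by (subst log_le_cancel_iff) auto
    ultimately show ?thesis using step by linarith
  qed
qed

lemma has_densityI:
  assumes "(\<lambda>n. real (card (A \<inter> {1..n})) / real n) \<longlonglongrightarrow> \<alpha>"
  shows "has_density A \<alpha>"
proof -
  have "(\<lambda>n. ereal (real (card (A \<inter> {1..n})) / real n)) \<longlonglongrightarrow> ereal \<alpha>"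
    using assms by simp
  then show ?thesis
    unfolding has_density_def upper_density_def lower_density_def
    by (simp add: lim_imp_Limsup lim_imp_Liminf)
qed

lemma has_density_digit_set:
  assumes "x \<in> {0..1}"
  shows "has_density (digit_set x) x"
proof (rule has_densityI)
  let ?f = "\<lambda>n. real (card (digit_set x \<inter> {1..n})) / real n"
  have "(\<lambda>n. ?f n - x) \<longlonglongrightarrow> 0"
  proof (rule tendsto_0_le [where K = 1])
    show "(\<lambda>n. log 2 (2 * real n) / 2 / real n) \<longlonglongrightarrow> 0"
      by real_asymp
    show "\<forall>\<^sub>F n in sequentially. norm (?f n - x) \<le> norm (log 2 (2 * real n) / 2 / real n) * 1"
      using eventually_gt_at_top [of 0]
    proof eventually_elim
      case (elim n)
      then have "?f n - x = (real (card (digit_set x \<inter> {1..n})) - x * real n) / real n"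
        by (simp add: field_simps)
      then have "norm (?f n - x) = \<bar>real (card (digit_set x \<inter> {1..n})) - x * real n\<bar> / real n"
        by simp
      also have "\<dots> \<le> log 2 (2 * real n) / 2 / real n"
        by (intro divide_right_mono digit_set_discrepancy assms elim) simp
      also have "\<dots> \<le> norm (log 2 (2 * real n) / 2 / real n) * 1"
        by (simp only: real_norm_def mult_1_right abs_ge_self)
      finally show ?case .
    qed
  qed
  then show "?f \<longlonglongrightarrow> x" by (rule LIM_zero_cancel)
qed

theorem theorem2p4:
  fixes \<alpha> :: real
  assumes "\<alpha> \<in> {0..1}"
  shows "\<exists>A. A \<subseteq> Npos \<and> has_density A \<alpha> \<and>
           \<not> (\<exists>B. B \<subseteq> Npos - A \<and> additive_complement B A)"
  using digit_set_subset_Npos has_density_digit_set [OF assms] not_additive_complement_digit_set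
  by blast

end
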